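(* Let $R$ be a commutative ring with nonzero identity, and let $x$ be a nonzero element of a unitary $R$-module $M$ such that $(0:_Rx)=0$ and $Rx\neq M$. Then $Rx$ is a prime submodule of $M$ if and only if $Rx$ is a $\phi_1$-prime submodule of $M$.
   Context: For a submodule $N$ of $M$, $(N:_RM)=\{r\in R: rM\subseteq N\}$, and $(0:_Rx)=\{r\in R: rx=0\}$. A proper submodule $P$ of $M$ is prime if for all $r\in R$, $y\in M$, $ry\in P$ implies $r\in(P:_RM)$ or $y\in P$. A proper submodule $P$ of $M$ is $\phi_1$-prime if for all $r\in R$, $y\in M$, $ry\in P\setminus (P:_RM)P$ implies $r\in(P:_RM)$ or $y\in P$. *)

theory Defs
  imports "HOL-Algebra.Module" "HOL-Algebra.Generated_Groups"
begin

definition submodule_colon ::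
    "('a, 'r) ring_scheme \<Rightarrow> ('a, 'b, 'm) module_scheme \<Rightarrow> 'b set \<Rightarrow> 'a set"
  where "submodule_colon R M N =
    {r \<in> carrier R. (\<lambda>m. r \<odot>\<^bsub>M\<^esub> m) ` carrier M \<subseteq> N}"

definition elem_annihilator ::
    "('a, 'r) ring_scheme \<Rightarrow> ('a, 'b, 'm) module_scheme \<Rightarrow> 'b \<Rightarrow> 'a set"
  where "elem_annihilator R M x = {r \<in> carrier R. r \<odot>\<^bsub>M\<^esub> x = \<zero>\<^bsub>M\<^esub>}"

definition cyclic_submodule ::
    "('a, 'r) ring_scheme \<Rightarrow> ('a, 'b, 'm) module_scheme \<Rightarrow> 'b \<Rightarrow> 'b set"
  where "cyclic_submodule R M x = (\<lambda>r. r \<odot>\<^bsub>M\<^esub> x) ` carrier R"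

text \<open>
  The product \<open>I N\<close> of an ideal \<open>I\<close> and a submodule \<open>N\<close> consists of all finite sums of
  elements \<open>a n\<close> with \<open>a \<in> I\<close> and \<open>n \<in> N\<close>. As \<open>I\<close> is closed under negation and under
  multiplication by scalars, this is the additive subgroup generated by these elements, and
  it is also the submodule they generate.
\<close>

definition ideal_submodule_prod ::
    "('a, 'b, 'm) module_scheme \<Rightarrow> 'a set \<Rightarrow> 'b set \<Rightarrow> 'b set"
  where "ideal_submodule_prod M I N =
    generate (add_monoid M) {a \<odot>\<^bsub>M\<^esub> n | a n. a \<in> I \<and> n \<in> N}"

definition prime_submodule ::
    "('a, 'r) ring_scheme \<Rightarrow> ('a, 'b, 'm) module_scheme \<Rightarrow> 'b set \<Rightarrow> bool"
  where "prime_submodule R M P \<longleftrightarrow>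
    submodule P R M \<and> P \<noteq> carrier M \<and>
    (\<forall>r \<in> carrier R. \<forall>y \<in> carrier M.
       r \<odot>\<^bsub>M\<^esub> y \<in> P \<longrightarrow> r \<in> submodule_colon R M P \<or> y \<in> P)"

definition phi1_prime_submodule ::
    "('a, 'r) ring_scheme \<Rightarrow> ('a, 'b, 'm) module_scheme \<Rightarrow> 'b set \<Rightarrow> bool"
  where "phi1_prime_submodule R M P \<longleftrightarrow>
    submodule P R M \<and> P \<noteq> carrier M \<and>
    (\<forall>r \<in> carrier R. \<forall>y \<in> carrier M.
       r \<odot>\<^bsub>M\<^esub> y \<in> P - ideal_submodule_prod M (submodule_colon R M P) P \<longrightarrow>
       r \<in> submodule_colon R M P \<or> y \<in> P)"

end

theory Submission
  imports Defs
begin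

text \<open>
  Let \<open>P = R x\<close> be \<open>\<phi>\<^sub>1\<close>-prime, with \<open>r y \<in> P\<close> and \<open>y \<notin> P\<close>. If \<open>r y\<close> lies in
  \<open>(P : M) P\<close>, replace \<open>y\<close> by \<open>y + x\<close>, which is still outside \<open>P\<close>. Either
  \<open>r (y + x) \<notin> (P : M) P\<close> and the \<open>\<phi>\<^sub>1\<close>-condition applies, or the difference \<open>r x\<close> lies
  in \<open>(P : M) P = (P : M) x\<close>, whence \<open>r \<in> (P : M)\<close> because \<open>x\<close> has zero annihilator.
\<close>

context module
begin

lemma submodule_colon_add_closed:
  assumes "submodule P R M" "a \<in> submodule_colon R M P" "b \<in> submodule_colon R M P"
  shows "a \<oplus>\<^bsub>R\<^esub> b \<in> submodule_colon R M P"
proof -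
  interpret P: submodule P R M by fact
  show ?thesis
    using assms(2,3) P.m_closed
    by (auto simp: submodule_colon_def smult_l_distr image_subset_iff)
qed

lemma submodule_colon_mult_closed:
  assumes "a \<in> submodule_colon R M P" "b \<in> carrier R"
  shows "a \<otimes>\<^bsub>R\<^esub> b \<in> submodule_colon R M P"
  using assms by (auto simp: submodule_colon_def smult_assoc1 image_subset_iff)

lemma submodule_colon_minus_closed:
  assumes "submodule P R M" "a \<in> submodule_colon R M P"
  shows "\<ominus>\<^bsub>R\<^esub> a \<in> submodule_colon R M P"
proof -
  interpret P: submodule P R M by fact
  \<comment> \<open>The subgroup facts for \<open>P\<close> concern the inverse in
    \<open>add_monoid M\<close>; unfolding \<open>a_inv_def\<close> identifies it with negation in
    \<open>M\<close>.\<close>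
  show ?thesis
    using assms(2) P.m_inv_closed
    by (auto simp: submodule_colon_def smult_l_minus image_subset_iff a_inv_def[of M])
qed

lemma zero_in_submodule_colon:
  assumes "submodule P R M"
  shows "\<zero>\<^bsub>R\<^esub> \<in> submodule_colon R M P"
proof -
  interpret P: submodule P R M by fact
  show ?thesis
    using P.one_closed by (auto simp: submodule_colon_def)
qed

text \<open>Since a(bx) = (ab)x and the colon absorbs multiplication by b, each generator of the
  product is a multiple of \<open>x\<close> with coefficient in the colon. These multiples form an
  additive subgroup, so they contain all that is generated.\<close>

lemma colon_prod_cyclic_subset:
  assumes x: "x \<in> carrier M" and P: "submodule P R M" "P = cyclic_submodule R M x"
  shows "ideal_submodule_prod M (submodule_colon R M P) P
           \<subseteq> (\<lambda>s. s \<odot>\<^bsub>M\<^esub> x) ` submodule_colon R M P" (is "_ \<subseteq> ?J")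
proof
  have carr: "s \<in> carrier R" if "s \<in> submodule_colon R M P" for s
    using that by (simp add: submodule_colon_def)
  fix z assume "z \<in> ideal_submodule_prod M (submodule_colon R M P) P"
  then have "z \<in> generate (add_monoid M)
      {a \<odot>\<^bsub>M\<^esub> n | a n. a \<in> submodule_colon R M P \<and> n \<in> P}"
    by (simp add: ideal_submodule_prod_def)
  moreover have gen: "a \<odot>\<^bsub>M\<^esub> n \<in> ?J" if a: "a \<in> submodule_colon R M P" and n: "n \<in> P" for a n
  proof -
    obtain b where b: "b \<in> carrier R" "n = b \<odot>\<^bsub>M\<^esub> x"
      using n P(2) by (auto simp: cyclic_submodule_def)
    then have "a \<odot>\<^bsub>M\<^esub> n = (a \<otimes>\<^bsub>R\<^esub> b) \<odot>\<^bsub>M\<^esub> x"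
      using x carr[OF a] by (simp add: smult_assoc1)
    with submodule_colon_mult_closed[OF a b(1)] show ?thesis by auto
  qed
  \<comment> \<open>Over \<open>add_monoid M\<close> the unit, inverses and products of
    \<open>generate\<close> are zero, negatives and sums; each is matched by the same operation on
    coefficients.\<close>
  ultimately show "z \<in> ?J"
  proof (induction rule: generate.induct)
    case one
    have "\<one>\<^bsub>add_monoid M\<^esub> = \<zero>\<^bsub>R\<^esub> \<odot>\<^bsub>M\<^esub> x" using x by simp
    then show ?case using zero_in_submodule_colon[OF P(1)] by auto
  next
    case (incl h)
    then show ?case by blast
  next
    case (inv h)
    then obtain s where s: "s \<in> submodule_colon R M P" "h = s \<odot>\<^bsub>M\<^esub> x" by blast
    then have "inv\<^bsub>add_monoid M\<^esub> h = (\<ominus>\<^bsub>R\<^esub> s) \<odot>\<^bsub>M\<^esub> x"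
      using x carr by (simp add: smult_l_minus a_inv_def[of M])
    with submodule_colon_minus_closed[OF P(1) s(1)] show ?case by auto
  next
    case (eng h1 h2)
    then obtain s t where st: "s \<in> submodule_colon R M P" "t \<in> submodule_colon R M P"
      "h1 = s \<odot>\<^bsub>M\<^esub> x" "h2 = t \<odot>\<^bsub>M\<^esub> x" by blast
    then have "h1 \<otimes>\<^bsub>add_monoid M\<^esub> h2 = (s \<oplus>\<^bsub>R\<^esub> t) \<odot>\<^bsub>M\<^esub> x"
      using x carr by (simp add: smult_l_distr)
    with submodule_colon_add_closed[OF P(1) st(1,2)] show ?case by auto
  qed
qed

text \<open>The difference of \<open>r\<close> and \<open>s\<close> kills \<open>x\<close>, so it
  vanishes. This turns equations between multiples of \<open>x\<close> into equations in
  \<open>R\<close>.\<close>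

lemma smult_right_cancel_of_annihilator:
  assumes "elem_annihilator R M x = {\<zero>\<^bsub>R\<^esub>}" "x \<in> carrier M"
    and "r \<in> carrier R" "s \<in> carrier R" "r \<odot>\<^bsub>M\<^esub> x = s \<odot>\<^bsub>M\<^esub> x"
  shows "r = s"
proof -
  have "(r \<ominus>\<^bsub>R\<^esub> s) \<odot>\<^bsub>M\<^esub> x = \<zero>\<^bsub>M\<^esub>"
    using assms(2-) by (simp add: R.minus_eq smult_l_distr smult_l_minus M.r_neg)
  then have "r \<ominus>\<^bsub>R\<^esub> s = \<zero>\<^bsub>R\<^esub>"
    using assms(1,3,4) by (auto simp: elem_annihilator_def)
  then show ?thesis using assms(3,4) R.minus_equality[of r "\<ominus>\<^bsub>R\<^esub> s"] by (simp add: R.minus_eq)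
qed

end

theorem corollary2p8:
  fixes R :: "('a, 'r) ring_scheme"
    and M :: "('a, 'b, 'm) module_scheme"
    and x :: 'b
  assumes "module R M"
    and "\<one>\<^bsub>R\<^esub> \<noteq> \<zero>\<^bsub>R\<^esub>"
    and "x \<in> carrier M"
    and "x \<noteq> \<zero>\<^bsub>M\<^esub>"
    and "elem_annihilator R M x = {\<zero>\<^bsub>R\<^esub>}"
    and "cyclic_submodule R M x \<noteq> carrier M"
  shows "prime_submodule R M (cyclic_submodule R M x) \<longleftrightarrow>
         phi1_prime_submodule R M (cyclic_submodule R M x)"
proof
  assume "prime_submodule R M (cyclic_submodule R M x)"
  \<comment> \<open>The \<phi>-condition demands the same conclusion for fewer products.\<close>
  then show "phi1_prime_submodule R M (cyclic_submodule R M x)"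
    by (auto simp: prime_submodule_def phi1_prime_submodule_def)
next
  interpret module R M by fact
  define P where "P = cyclic_submodule R M x"
  let ?C = "submodule_colon R M P"
  let ?I = "ideal_submodule_prod M ?C P"
  assume "phi1_prime_submodule R M (cyclic_submodule R M x)"
  then have sub: "submodule P R M"
    and phi: "\<And>r y. r \<in> carrier R \<Longrightarrow> y \<in> carrier M \<Longrightarrow> r \<odot>\<^bsub>M\<^esub> y \<in> P - ?I \<Longrightarrow> r \<in> ?C \<or> y \<in> P"
    by (auto simp: phi1_prime_submodule_def P_def)
  interpret P: submodule P R M by fact
  have "\<one>\<^bsub>R\<^esub> \<odot>\<^bsub>M\<^esub> x \<in> P"
    by (auto simp: P_def cyclic_submodule_def)
  then have xP: "x \<in> P" using assms(3) by simp
  have I: "?I \<subseteq> (\<lambda>s. s \<odot>\<^bsub>M\<^esub> x) ` ?C"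
    using colon_prod_cyclic_subset[OF assms(3) sub P_def] .
  have "r \<in> ?C" if r: "r \<in> carrier R" and y: "y \<in> carrier M" and ry: "r \<odot>\<^bsub>M\<^esub> y \<in> P" and yP: "y \<notin> P" for r y
  \<comment> \<open>If either product escapes \<open>?I\<close>, then \<open>phi\<close> applies to
    it; only when both lie in \<open>?I\<close> does the annihilator enter.\<close>
  proof (cases "r \<odot>\<^bsub>M\<^esub> y \<in> ?I \<and> r \<odot>\<^bsub>M\<^esub> (y \<oplus>\<^bsub>M\<^esub> x) \<in> ?I")
    case True
    then obtain s t where s: "s \<in> ?C" "r \<odot>\<^bsub>M\<^esub> y = s \<odot>\<^bsub>M\<^esub> x"
      and t: "t \<in> ?C" "r \<odot>\<^bsub>M\<^esub> (y \<oplus>\<^bsub>M\<^esub> x) = t \<odot>\<^bsub>M\<^esub> x"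
      using I by blast
    have carr: "s \<in> carrier R" "t \<in> carrier R"
      using s t by (auto simp: submodule_colon_def)
    \<comment> \<open>This difference turns out to be \<open>r\<close> itself, once \<open>x\<close>
      is cancelled from tx = (s + r)x.\<close>
    have diff: "t \<oplus>\<^bsub>R\<^esub> \<ominus>\<^bsub>R\<^esub> s \<in> ?C"
      using s(1) t(1) sub submodule_colon_add_closed submodule_colon_minus_closed by blast
    have "t \<odot>\<^bsub>M\<^esub> x = s \<odot>\<^bsub>M\<^esub> x \<oplus>\<^bsub>M\<^esub> r \<odot>\<^bsub>M\<^esub> x"
      using s(2) t(2) r y assms(3) by (simp add: smult_r_distr)
    then have "t \<odot>\<^bsub>M\<^esub> x = (s \<oplus>\<^bsub>R\<^esub> r) \<odot>\<^bsub>M\<^esub> x"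
      using carr r assms(3) by (simp add: smult_l_distr)
    then have "t = s \<oplus>\<^bsub>R\<^esub> r"
      using smult_right_cancel_of_annihilator[OF assms(5,3)] carr r by simp
    then have "t \<oplus>\<^bsub>R\<^esub> \<ominus>\<^bsub>R\<^esub> s = r"
      using carr r by (simp add: R.a_ac R.r_neg)
    with diff show ?thesis by simp
  next
    case False
    \<comment> \<open>Otherwise subtracting \<open>x\<close>, an element of \<open>P\<close>, would
      put \<open>y\<close> in \<open>P\<close>.\<close>
    have "y \<oplus>\<^bsub>M\<^esub> x \<notin> P"
    proof
      assume "y \<oplus>\<^bsub>M\<^esub> x \<in> P"
      then have "(y \<oplus>\<^bsub>M\<^esub> x) \<oplus>\<^bsub>M\<^esub> \<ominus>\<^bsub>M\<^esub> x \<in> P"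
        using P.m_closed P.m_inv_closed[OF xP] by (simp add: a_inv_def[of M])
      with yP y assms(3) show False by (simp add: M.a_assoc M.r_neg)
    qed
    moreover have "r \<odot>\<^bsub>M\<^esub> (y \<oplus>\<^bsub>M\<^esub> x) \<in> P"
      using ry P.smult_closed[OF r xP] P.m_closed r y assms(3) by (simp add: smult_r_distr)
    \<comment> \<open>Both \<open>y\<close> and its translate lie outside \<open>P\<close>, so
      whichever instance of \<open>phi\<close> fires leaves only the colon.\<close>
    ultimately show ?thesis
      using False phi[OF r, of y] phi[OF r, of "y \<oplus>\<^bsub>M\<^esub> x"] y yP ry assms(3) by auto
  qed
  with sub assms(6) show "prime_submodule R M (cyclic_submodule R M x)"
    by (auto simp: prime_submodule_def P_def)
qed

end
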